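(* Let $G=\mathrm{GL}_n$ over $\mathbb{C}$ with diagonal maximal torus $T$ and Weyl group $W$. The class of the determinant line bundle on $\mathrm{Gr}_{\mathrm{GL}_n}$ does not lie in the ring of functions on the uncompleted deformation: $$[\mathcal{L}_{\det}]\notin\mathcal{O}\big(\mathcal{N}_{\mu_\infty}(\mathcal{Z},T\times T/\!\!/W)\big).$$ That is, there is no $f\in\mathcal{O}(\mathcal{N}_{\mu_\infty}(\mathcal{Z},T\times T/\!\!/W))$ such that for every $\lambda\in X_\bullet(T)$ the function $\gamma_\lambda(f)\in\mathcal{O}(T\times\mathbb{G}_m^{\mathrm{rot}})$ equals the restriction of $[\mathcal{L}_{\det}]\in K^{\mathrm{top},0}_{T\times\mathbb{G}_m^{\mathrm{rot}}}(\mathrm{Gr}_{\mathrm{GL}_n};\mathbb{C})$ to the fixed point $t^\lambda$.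
   Context: $\mathrm{Gr}_{\mathrm{GL}_n}$ is the affine Grassmannian of lattices $\Lambda\subset\mathbb{C}(\!(t)\!)^{\oplus n}$, with base point $\Lambda_0=\mathbb{C}[[t]]^{\oplus n}$, with the action of $T$ and of $\mathbb{G}_m^{\mathrm{rot}}=\mathrm{Spec}\,\mathbb{C}[q^{\pm1}]$ by loop rotation; the vector $t^k e_i$ has $T\times\mathbb{G}_m^{\mathrm{rot}}$-weight $t_iq^k$. The fixed points are $t^\lambda=t^\lambda\Lambda_0$, $\lambda=(d_1,\dots,d_n)\in X_\bullet(T)=\mathbb{Z}^n$. $K^{\mathrm{top},0}_{T\times\mathbb{G}_m^{\mathrm{rot}}}(-;\mathbb{C})$ is the degree $0$ part of genuine equivariant topological $K$-theory with $\mathbb{C}$-coefficients; restriction to the fixed points embeds $K^{\mathrm{top},0}_{T\times\mathbb{G}_m^{\mathrm{rot}}}(\mathrm{Gr}_{\mathrm{GL}_n};\mathbb{C})$ into $\prod_\lambda\mathcal{O}(T\times\mathbb{G}_m^{\mathrm{rot}})$. Determinant line bundle: on each affine Schubert variety $\mathrm{Gr}_{\le\mu}$ choose $m\gg0$ with $t^m\Lambda_0\subseteq\Lambda\subseteq t^{-m}\Lambda_0$ for all $\Lambda\in\mathrm{Gr}_{\le\mu}$, and set $\mathcal{L}_{\det}|_\Lambda=\det(t^{-m}\Lambda_0/\Lambda)\otimes\det(t^{-m}\Lambda_0/\Lambda_0)^{-1}$; this is independent of $m$, compatible in $\mu$, and naturally $T\times\mathbb{G}_m^{\mathrm{rot}}$-equivariant.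 Deformation: for $\ell\in\mathbb{N}$, $Z_\ell\subseteq T\times T/\!\!/W$ is the closed subscheme of pairs $(x,y)$ with $x^\ell\equiv y^\ell$ in $T/\!\!/W$ (scheme-theoretic fiber product of the $\ell$-power maps over $T/\!\!/W$), with ideal $\mathcal{I}_{Z_\ell}$. $\mathcal{O}(\mathcal{N}_{\mu_\infty}(\mathcal{Z},T\times T/\!\!/W))$ is the subring $\mathcal{O}(T\times T/\!\!/W)[q^{\pm1}][\tfrac{f}{1-q^\ell}:\ell\in\mathbb{N},f\in\mathcal{I}_{Z_\ell}]$ of the localization of $\mathcal{O}(T\times T/\!\!/W)[q^{\pm1}]$ at all $1-q^\ell$ (functions on the affine blowup of $T\times\mathbb{G}_m^{\mathrm{rot}}\times T/\!\!/W$ at $Z_\ell\times\{\zeta\}$ for all roots of unity $\zeta$ of primitive order $\ell$). For $\lambda\in X_\bullet(T)$, $\gamma_\lambda$ is the unique ring map $\mathcal{O}(\mathcal{N}_{\mu_\infty}(\mathcal{Z},T\times T/\!\!/W))\to\mathcal{O}(T\times\mathbb{G}_m^{\mathrm{rot}})$ extending $f(x,\zeta,y)\mapsto f(x,\zeta,\lambda(\zeta)x)$. The product $\prod_\lambda\gamma_\lambda$ is how this ring is compared with $K$-theory. *)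

theory Defs
  imports
    "HOL-Analysis.Finite_Cartesian_Product"
    "HOL-Analysis.Product_Vector"
    "HOL-Library.Poly_Mapping"
    "HOL-Computational_Algebra.Computational_Algebra"
    "Jordan_Normal_Form.Determinant"
begin

no_notation Matrix.vec_index (infixl \<open>$\<close> 100)
no_notation Matrix.index_mat (infixl \<open>$$\<close> 100)
no_notation fps_nth (infixl \<open>$\<close> 75)
hide_fact (open) Matrix.vec_eq_iff

text \<open>
  Throughout, \<open>'n\<close> is a finite index type with \<open>CARD('n) = n\<close>, so \<open>n \<ge> 1\<close>.  The lattice
  \<open>int ^ 'n\<close> serves both as the character lattice and as the cocharacter lattice of the diagonal
  torus \<open>T\<close> of \<open>GL\<^sub>n\<close>.  The ring \<open>O(T)\<close> is the group algebra \<open>int ^ 'n \<Rightarrow>\<^sub>0 complex\<close>, in which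
  \<open>Poly_Mapping.single a 1\<close> is the character \<open>x \<mapsto> \<Prod>i. x\<^sub>i ^ a\<^sub>i\<close>.
\<close>

section \<open>The functions on the uncompleted deformation\<close>

definition weyl_invariant :: "(int ^ 'n \<Rightarrow>\<^sub>0 complex) \<Rightarrow> bool" where
  "weyl_invariant h \<longleftrightarrow>
     (\<forall>\<sigma>::'n \<Rightarrow> 'n. bij \<sigma> \<longrightarrow>
        (\<forall>a. Poly_Mapping.lookup h (\<chi> i. a $ \<sigma> i) = Poly_Mapping.lookup h a))"

text \<open>
  In \<open>O(T \<times> T)\<close> the key \<open>(a, b)\<close> is the monomial \<open>x\<^sup>a y\<^sup>b\<close>; the functions on \<open>T \<times> T//W\<close> are the
  functions on \<open>T \<times> T\<close> invariant under the Weyl group acting on the second factor.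
\<close>

definition O_TxTW :: "((int ^ 'n) \<times> (int ^ 'n) \<Rightarrow>\<^sub>0 complex) set" where
  "O_TxTW = {F. \<forall>\<sigma>::'n \<Rightarrow> 'n. bij \<sigma> \<longrightarrow>
     (\<forall>a b. Poly_Mapping.lookup F (a, \<chi> i. b $ \<sigma> i) = Poly_Mapping.lookup F (a, b))}"

text \<open>The functions \<open>h(x\<^sup>l)\<close> and \<open>h(y\<^sup>l)\<close> on \<open>T \<times> T\<close>.\<close>

definition power_pullback_left ::
    "nat \<Rightarrow> (int ^ 'n \<Rightarrow>\<^sub>0 complex) \<Rightarrow> ((int ^ 'n) \<times> (int ^ 'n) \<Rightarrow>\<^sub>0 complex)" where
  "power_pullback_left l h =
     (\<Sum>a\<in>Poly_Mapping.keys h. Poly_Mapping.single (int l *s a, 0) (Poly_Mapping.lookup h a))"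

definition power_pullback_right ::
    "nat \<Rightarrow> (int ^ 'n \<Rightarrow>\<^sub>0 complex) \<Rightarrow> ((int ^ 'n) \<times> (int ^ 'n) \<Rightarrow>\<^sub>0 complex)" where
  "power_pullback_right l h =
     (\<Sum>a\<in>Poly_Mapping.keys h. Poly_Mapping.single (0, int l *s a) (Poly_Mapping.lookup h a))"

text \<open>
  The ideal of the scheme-theoretic fibre product of the \<open>l\<close>-power maps \<open>T \<rightarrow> T//W\<close> and
  \<open>T//W \<rightarrow> T//W\<close>: it is generated by the differences of the two pullbacks of functions on \<open>T//W\<close>,
  and no radical is taken.
\<close>

inductive_set Z_ideal :: "nat \<Rightarrow> ((int ^ 'n) \<times> (int ^ 'n) \<Rightarrow>\<^sub>0 complex) set" for l :: nat where
  gen: "weyl_invariant h \<Longrightarrow> power_pullback_left l h - power_pullback_right l h \<in> Z_ideal l"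
| add: "F \<in> Z_ideal l \<Longrightarrow> G \<in> Z_ideal l \<Longrightarrow> F + G \<in> Z_ideal l"
| mult: "R \<in> O_TxTW \<Longrightarrow> F \<in> Z_ideal l \<Longrightarrow> R * F \<in> Z_ideal l"

text \<open>
  The coordinate \<open>q\<close> of the rotation torus is the variable of the rational function field
  \<open>complex poly fract\<close>.  The localization of \<open>O(T \<times> T//W)[q\<^sup>\<plusminus>\<^sup>1]\<close> at all \<open>1 - q\<^sup>l\<close> is a
  subring of the group algebra of \<open>int ^ 'n \<times> int ^ 'n\<close> over that field, and
  \<open>O(T \<times> G\<^sub>m)\<close> is a subring of the group algebra of \<open>int ^ 'n\<close> over it.
\<close>

definition qv :: "complex poly fract" where
  "qv = to_fract [:0, 1:]"

definition const_q :: "complex \<Rightarrow> complex poly fract" where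
  "const_q c = to_fract [:c:]"

definition laurent_q :: "complex poly fract set" where
  "laurent_q = {to_fract p * qv powi k |p k. True}"

definition O_TxGm :: "(int ^ 'n \<Rightarrow>\<^sub>0 complex poly fract) set" where
  "O_TxGm = {g. \<forall>a. Poly_Mapping.lookup g a \<in> laurent_q}"

definition extend_q ::
    "((int ^ 'n) \<times> (int ^ 'n) \<Rightarrow>\<^sub>0 complex) \<Rightarrow> ((int ^ 'n) \<times> (int ^ 'n) \<Rightarrow>\<^sub>0 complex poly fract)"
  where "extend_q F = Poly_Mapping.map const_q F"

text \<open>
  The exponent \<open>l = 0\<close> is excluded, since \<open>1 - q\<^sup>0 = 0\<close> is not inverted.
\<close>

inductive_set deformation_ring :: "((int ^ 'n) \<times> (int ^ 'n) \<Rightarrow>\<^sub>0 complex poly fract) set" where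
  base: "F \<in> O_TxTW \<Longrightarrow> extend_q F \<in> deformation_ring"
| q_power: "Poly_Mapping.single 0 (qv powi k) \<in> deformation_ring"
| blowup: "0 < l \<Longrightarrow> F \<in> Z_ideal l \<Longrightarrow>
    Poly_Mapping.single 0 (inverse (1 - qv ^ l)) * extend_q F \<in> deformation_ring"
| add: "F \<in> deformation_ring \<Longrightarrow> G \<in> deformation_ring \<Longrightarrow> F + G \<in> deformation_ring"
| mult: "F \<in> deformation_ring \<Longrightarrow> G \<in> deformation_ring \<Longrightarrow> F * G \<in> deformation_ring"

text \<open>
  Pullback along \<open>(x, q) \<mapsto> (x, q, d(q) x)\<close>: the substitution \<open>y\<^sub>i = q ^ d\<^sub>i x\<^sub>i\<close>
  sends \<open>x\<^sup>a y\<^sup>b\<close> to \<open>q ^ (\<Sum>i. d\<^sub>i b\<^sub>i) x ^ (a + b)\<close>.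
\<close>

definition gamma ::
    "int ^ 'n \<Rightarrow> ((int ^ 'n) \<times> (int ^ 'n) \<Rightarrow>\<^sub>0 complex poly fract)
      \<Rightarrow> (int ^ 'n \<Rightarrow>\<^sub>0 complex poly fract)" where
  "gamma d F =
     (\<Sum>(a, b)\<in>Poly_Mapping.keys F.
        Poly_Mapping.single (a + b)
          (Poly_Mapping.lookup F (a, b) * qv powi (\<Sum>i\<in>UNIV. d $ i * b $ i)))"

lemma additive_sum_single:
  fixes w :: "'a \<Rightarrow> 'b::comm_monoid_add \<Rightarrow> 'd::comm_monoid_add" and \<phi> :: "'a \<Rightarrow> 'c"
  assumes w0: "\<And>k. w k 0 = 0" and wadd: "\<And>k c e. w k (c + e) = w k c + w k e"
  defines "L \<equiv> \<lambda>F. \<Sum>k\<in>Poly_Mapping.keys F. Poly_Mapping.single (\<phi> k) (w k (Poly_Mapping.lookup F k))"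
  shows "L (F + G) = L F + L G"
proof -
  let ?K = "Poly_Mapping.keys F \<union> Poly_Mapping.keys G"
  have super: "L H = (\<Sum>k\<in>?K. Poly_Mapping.single (\<phi> k) (w k (Poly_Mapping.lookup H k)))"
    if "Poly_Mapping.keys H \<subseteq> ?K" for H
    unfolding L_def
    by (rule sum.mono_neutral_left) (use that in \<open>auto simp: in_keys_iff w0\<close>)
  have "L (F + G) = (\<Sum>k\<in>?K. Poly_Mapping.single (\<phi> k) (w k (Poly_Mapping.lookup (F + G) k)))"
    by (rule super) (rule Poly_Mapping.keys_add)
  also have "\<dots> = L F + L G"
    by (simp add: super lookup_add wadd single_add sum.distrib)
  finally show ?thesis .
qed

lemma multiplicative_sum_single:
  fixes w :: "'a::comm_monoid_add \<Rightarrow> 'b::comm_ring_1 \<Rightarrow> 'd::comm_ring_1"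
    and \<phi> :: "'a \<Rightarrow> 'c::comm_monoid_add"
  assumes w0: "\<And>k. w k 0 = 0" and wadd: "\<And>k c e. w k (c + e) = w k c + w k e"
    and wmult: "\<And>k l c e. w (k + l) (c * e) = w k c * w l e"
    and \<phi>: "\<And>k l. \<phi> (k + l) = \<phi> k + \<phi> l"
  defines "L \<equiv> \<lambda>F. \<Sum>k\<in>Poly_Mapping.keys F. Poly_Mapping.single (\<phi> k) (w k (Poly_Mapping.lookup F k))"
  shows "L (F * G) = L F * L G"
proof -
  have expand: "H = (\<Sum>k\<in>Poly_Mapping.keys H. Poly_Mapping.single k (Poly_Mapping.lookup H k))"
    for H :: "'a \<Rightarrow>\<^sub>0 'b"
    by (rule poly_mapping_eqI) (simp add: lookup_sum lookup_single when_def in_keys_iff)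
  have Ladd: "L (H + H') = L H + L H'" for H H'
    unfolding L_def by (rule additive_sum_single) (simp_all add: w0 wadd)
  have L0: "L 0 = 0"
    by (simp add: L_def)
  have Lsum: "L (\<Sum>i\<in>I. H i) = (\<Sum>i\<in>I. L (H i))" if "finite I" for I :: "'i set" and H
    using that by induction (simp_all add: Ladd L0)
  have Lsingle: "L (Poly_Mapping.single k c) = Poly_Mapping.single (\<phi> k) (w k c)" for k c
    by (cases "c = 0") (simp_all add: L_def w0)
  have "L (F * G) = L (\<Sum>k\<in>Poly_Mapping.keys F. \<Sum>l\<in>Poly_Mapping.keys G.
      Poly_Mapping.single (k + l) (Poly_Mapping.lookup F k * Poly_Mapping.lookup G l))"
    by (subst (1) expand[of F], subst (1) expand[of G]) (simp add: sum_product Poly_Mapping.mult_single)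
  also have "\<dots> = (\<Sum>k\<in>Poly_Mapping.keys F. \<Sum>l\<in>Poly_Mapping.keys G.
      Poly_Mapping.single (\<phi> k) (w k (Poly_Mapping.lookup F k)) *
      Poly_Mapping.single (\<phi> l) (w l (Poly_Mapping.lookup G l)))"
    by (simp add: Lsum Lsingle wmult \<phi> Poly_Mapping.mult_single)
  also have "\<dots> = L F * L G"
    by (simp add: L_def sum_product)
  finally show ?thesis .
qed

lemma qv_neq_0 [simp]: "qv \<noteq> 0"
  by (simp add: qv_def)

lemma qv_power: "qv ^ l = to_fract (monom 1 l)"
  by (induction l) (simp_all add: qv_def monom_Suc one_pCons[symmetric] flip: to_fract_mult)

lemma one_minus_qv_power_neq_0: "1 - qv ^ l \<noteq> 0" if "0 < l"
proof
  assume "1 - qv ^ l = 0"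
  then have "to_fract (monom 1 l) = to_fract (1 :: complex poly)"
    by (simp add: qv_power)
  then have "monom 1 l = (1 :: complex poly)"
    by (simp only: to_fract_eq_iff)
  then have "degree (monom 1 l :: complex poly) = 0"
    by simp
  with that show False
    by (simp add: degree_monom_eq)
qed

lemma const_q_simps: "const_q 0 = 0" "const_q 1 = 1" "const_q (c + e) = const_q c + const_q e"
    "const_q (c * e) = const_q c * const_q e" "const_q (- c) = - const_q c"
  by (simp_all add: const_q_def flip: to_fract_add to_fract_mult to_fract_uminus one_pCons)

lemma extend_q_eq:
  "extend_q F = (\<Sum>k\<in>Poly_Mapping.keys F. Poly_Mapping.single k (const_q (Poly_Mapping.lookup F k)))"
  by (rule poly_mapping_eqI)
    (simp add: extend_q_def Poly_Mapping.map.rep_eq lookup_sum lookup_single when_def in_keys_iff const_q_simps)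

lemma extend_q_add: "extend_q (F + G) = extend_q F + extend_q G"
  unfolding extend_q_eq by (rule additive_sum_single) (simp_all add: const_q_simps)

lemma extend_q_mult: "extend_q (F * G) = extend_q F * extend_q G"
  unfolding extend_q_eq by (rule multiplicative_sum_single) (simp_all add: const_q_simps)

lemma extend_q_single: "extend_q (Poly_Mapping.single k c) = Poly_Mapping.single k (const_q c)"
  by (cases "c = 0") (simp_all add: extend_q_eq const_q_simps)

lemma gamma_eq:
  "gamma d F = (\<Sum>k\<in>Poly_Mapping.keys F. Poly_Mapping.single (fst k + snd k)
     (Poly_Mapping.lookup F k * qv powi (\<Sum>i\<in>UNIV. d $ i * snd k $ i)))"
  by (simp add: gamma_def case_prod_unfold)

lemma gamma_add: "gamma d (F + G) = gamma d F + gamma d G"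
  unfolding gamma_eq by (rule additive_sum_single) (simp_all add: algebra_simps)

lemma gamma_mult: "gamma d (F * G) = gamma d F * gamma d G"
  unfolding gamma_eq
  by (rule multiplicative_sum_single)
    (simp_all add: algebra_simps sum.distrib power_int_add)

lemma gamma_single:
  "gamma d (Poly_Mapping.single (a, b) c) =
     Poly_Mapping.single (a + b) (c * qv powi (\<Sum>i\<in>UNIV. d $ i * b $ i))"
  by (cases "c = 0") (simp_all add: gamma_eq)

lemma gamma_one: "gamma d 1 = 1"
  using gamma_single[of d 0 0 1] by (simp flip: zero_prod_def)

lemma laurent_q_mono: "to_fract p * qv powi k \<in> laurent_q"
  unfolding laurent_q_def by blast

lemma laurent_q_qv: "qv powi k \<in> laurent_q"
  using laurent_q_mono[of 1 k] by simp

lemma laurent_q_const: "const_q c \<in> laurent_q"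
  using laurent_q_mono[of "[:c:]" 0] by (simp add: const_q_def)

lemma laurent_q_mult: "u * v \<in> laurent_q" if "u \<in> laurent_q" "v \<in> laurent_q"
proof -
  from that obtain p k r l where "u = to_fract p * qv powi k" "v = to_fract r * qv powi l"
    unfolding laurent_q_def by blast
  then have "u * v = to_fract (p * r) * qv powi (k + l)"
    by (simp add: power_int_add)
  then show ?thesis
    by (simp only: laurent_q_mono)
qed

lemma laurent_q_add: "u + v \<in> laurent_q" if "u \<in> laurent_q" "v \<in> laurent_q"
proof -
  have shift: "to_fract p * qv powi k = to_fract (p * monom 1 (nat (k - m))) * qv powi m"
    if "m \<le> k" for p k m
    using that power_int_add[of qv "k - m" m] by (simp add: power_int_def flip: qv_power)
  from that obtain p k r l where "u = to_fract p * qv powi k" "v = to_fract r * qv powi l"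
    unfolding laurent_q_def by blast
  then have "u + v = to_fract (p * monom 1 (nat (k - min k l)) + r * monom 1 (nat (l - min k l)))
      * qv powi min k l"
    using shift[of "min k l" k p] shift[of "min k l" l r] by (simp add: algebra_simps)
  then show ?thesis
    by (simp only: laurent_q_mono)
qed

lemma laurent_q_0: "0 \<in> laurent_q"
  using laurent_q_const[of 0] by (simp add: const_q_simps)

lemma laurent_q_sum: "(\<And>i. i \<in> I \<Longrightarrow> f i \<in> laurent_q) \<Longrightarrow> (\<Sum>i\<in>I. f i) \<in> laurent_q"
  by (induction I rule: infinite_finite_induct) (auto intro: laurent_q_add laurent_q_0)

lemma O_TxGm_add: "F \<in> O_TxGm \<Longrightarrow> G \<in> O_TxGm \<Longrightarrow> F + G \<in> O_TxGm"
  by (simp add: O_TxGm_def lookup_add laurent_q_add)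

lemma O_TxGm_sum: "(\<And>i. i \<in> I \<Longrightarrow> f i \<in> O_TxGm) \<Longrightarrow> (\<Sum>i\<in>I. f i) \<in> O_TxGm"
  by (simp add: O_TxGm_def lookup_sum laurent_q_sum)

lemma O_TxGm_single: "c \<in> laurent_q \<Longrightarrow> Poly_Mapping.single a c \<in> O_TxGm"
  by (simp add: O_TxGm_def lookup_single when_def laurent_q_0)

lemma O_TxGm_mult: "F * G \<in> O_TxGm" if "F \<in> O_TxGm" "G \<in> O_TxGm"
proof -
  have expand: "H = (\<Sum>k\<in>Poly_Mapping.keys H. Poly_Mapping.single k (Poly_Mapping.lookup H k))"
    for H :: "int ^ 'n \<Rightarrow>\<^sub>0 complex poly fract"
    by (rule poly_mapping_eqI) (simp add: lookup_sum lookup_single when_def in_keys_iff)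
  have "F * G = (\<Sum>k\<in>Poly_Mapping.keys F. \<Sum>l\<in>Poly_Mapping.keys G.
      Poly_Mapping.single (k + l) (Poly_Mapping.lookup F k * Poly_Mapping.lookup G l))"
    by (subst (1) expand[of F], subst (1) expand[of G]) (simp add: sum_product Poly_Mapping.mult_single)
  also have "\<dots> \<in> O_TxGm"
    using that by (intro O_TxGm_sum O_TxGm_single laurent_q_mult) (simp_all add: O_TxGm_def)
  finally show ?thesis .
qed

lemma gamma_extend_q: "gamma d (extend_q F) \<in> O_TxGm"
  unfolding gamma_eq
  by (intro O_TxGm_sum O_TxGm_single laurent_q_mult laurent_q_qv)
    (simp add: extend_q_def Poly_Mapping.map.rep_eq when_def laurent_q_const laurent_q_0)

lemma one_minus_qv_power_dvd:
  "\<exists>u\<in>laurent_q. 1 - qv powi (int l * m) = (1 - qv ^ l) * u"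
proof -
  have nat: "\<exists>u\<in>laurent_q. 1 - qv powi (int l * int j) = (1 - qv ^ l) * u" for j
  proof -
    have "1 - qv powi (int l * int j) = 1 - (qv ^ l) ^ j"
      by (simp add: power_mult flip: of_nat_mult)
    also have "\<dots> = (1 - qv ^ l) * (\<Sum>i<j. (qv ^ l) ^ i)"
      by (rule one_diff_power_eq)
    moreover have "(qv ^ l) ^ i \<in> laurent_q" for i
      using laurent_q_qv[of "int (l * i)"] by (simp add: power_mult del: of_nat_mult)
    ultimately show ?thesis
      by (metis laurent_q_sum)
  qed
  show ?thesis
  proof (cases "0 \<le> m")
    case True
    then show ?thesis using nat[of "nat m"] by simp
  next
    case False
    from nat[of "nat (- m)"] obtain u where u: "u \<in> laurent_q"
      "1 - qv powi (int l * (- m)) = (1 - qv ^ l) * u"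
      using False by (metis int_nat_eq nle_le neg_0_le_iff_le)
    have "1 - qv powi (int l * m) = - (qv powi (int l * m) * (1 - qv powi (int l * (- m))))"
      by (simp add: algebra_simps flip: power_int_add)
    also have "\<dots> = (1 - qv ^ l) * (const_q (- 1) * qv powi (int l * m) * u)"
      by (subst u(2)) (simp add: const_q_simps)
    finally show ?thesis
      using u(1) by (metis laurent_q_const laurent_q_mult laurent_q_qv)
  qed
qed

lemma gamma_Z_ideal:
  fixes d :: "int ^ 'n"
  assumes "F \<in> Z_ideal l"
  shows "\<exists>G\<in>O_TxGm. gamma d (extend_q F) = Poly_Mapping.single 0 (1 - qv ^ l) * G"
  using assms
proof induction
  case (gen h)
  have hom: "gamma d (extend_q (F + G)) = gamma d (extend_q F) + gamma d (extend_q G)" for F G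
    by (simp add: extend_q_add gamma_add)
  have zero: "gamma d (extend_q 0) = 0"
    by (simp add: extend_q_eq gamma_eq)
  have hom_sum: "gamma d (extend_q (\<Sum>i\<in>I. f i)) = (\<Sum>i\<in>I. gamma d (extend_q (f i)))"
    if "finite I" for I :: "(int ^ 'n) set" and f
    using that by induction (simp_all add: hom zero)
  have hom_diff: "gamma d (extend_q (F - G)) = gamma d (extend_q F) - gamma d (extend_q G)" for F G
    using hom[of "F - G" G] by simp
  define e where "e a = (\<Sum>i\<in>UNIV. d $ i * a $ i)" for a :: "int ^ 'n"
  have e: "(\<Sum>i\<in>UNIV. d $ i * (int l *s a) $ i) = int l * e a" for a
    by (simp add: e_def sum_distrib_left mult_ac)
  obtain u where u: "\<And>m. u m \<in> laurent_q" "\<And>m. 1 - qv powi (int l * m) = (1 - qv ^ l) * u m"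
    using one_minus_qv_power_dvd[of l] by metis
  define G where "G = (\<Sum>a\<in>Poly_Mapping.keys h.
    Poly_Mapping.single (int l *s a) (const_q (Poly_Mapping.lookup h a) * u (e a)))"
  have "gamma d (extend_q (power_pullback_left l h - power_pullback_right l h)) =
    (\<Sum>a\<in>Poly_Mapping.keys h. Poly_Mapping.single (int l *s a)
       (const_q (Poly_Mapping.lookup h a) * (1 - qv powi (int l * e a))))"
    by (simp add: hom_diff power_pullback_left_def power_pullback_right_def hom_sum extend_q_single
        gamma_single e right_diff_distrib single_diff sum_subtractf del: vector_smult_component)
  also have "\<dots> = Poly_Mapping.single 0 (1 - qv ^ l) * G"
    by (simp add: G_def sum_distrib_left Poly_Mapping.mult_single u(2) mult_ac)
  moreover have "G \<in> O_TxGm"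
    unfolding G_def by (intro O_TxGm_sum O_TxGm_single laurent_q_mult laurent_q_const u)
  ultimately show ?case
    by metis
next
  case (add F G)
  then obtain F' G' where *: "F' \<in> O_TxGm" "G' \<in> O_TxGm"
    "gamma d (extend_q F) = Poly_Mapping.single 0 (1 - qv ^ l) * F'"
    "gamma d (extend_q G) = Poly_Mapping.single 0 (1 - qv ^ l) * G'"
    by blast
  have "gamma d (extend_q (F + G)) = Poly_Mapping.single 0 (1 - qv ^ l) * (F' + G')"
    unfolding extend_q_add gamma_add * distrib_left ..
  with O_TxGm_add[OF *(1,2)] show ?case ..
next
  case (mult R F)
  then obtain F' where *: "F' \<in> O_TxGm"
    "gamma d (extend_q F) = Poly_Mapping.single 0 (1 - qv ^ l) * F'"
    by blast
  have "gamma d (extend_q (R * F)) = Poly_Mapping.single 0 (1 - qv ^ l) * (gamma d (extend_q R) * F')"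
    unfolding extend_q_mult gamma_mult * by (rule mult.left_commute)
  with O_TxGm_mult[OF gamma_extend_q *(1)] show ?case ..
qed

lemma O_TxTW_add: "F \<in> O_TxTW \<Longrightarrow> G \<in> O_TxTW \<Longrightarrow> F + G \<in> O_TxTW"
  by (simp add: O_TxTW_def lookup_add)

lemma O_TxTW_diff: "F \<in> O_TxTW \<Longrightarrow> G \<in> O_TxTW \<Longrightarrow> F - G \<in> O_TxTW"
  by (simp add: O_TxTW_def lookup_minus)

lemma O_TxTW_mult:
  fixes F G :: "(int ^ 'n) \<times> (int ^ 'n) \<Rightarrow>\<^sub>0 complex"
  assumes "F \<in> O_TxTW" "G \<in> O_TxTW"
  shows "F * G \<in> O_TxTW"
proof -
  define \<phi> :: "('n \<Rightarrow> 'n) \<Rightarrow> (int ^ 'n) \<times> (int ^ 'n) \<Rightarrow> (int ^ 'n) \<times> (int ^ 'n)"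
    where "\<phi> \<sigma> k = (fst k, \<chi> i. snd k $ \<sigma> i)" for \<sigma> k
  define L where "L \<sigma> H = (\<Sum>k\<in>Poly_Mapping.keys H. Poly_Mapping.single (\<phi> \<sigma> k) (Poly_Mapping.lookup H k))"
    for \<sigma> and H :: "(int ^ 'n) \<times> (int ^ 'n) \<Rightarrow>\<^sub>0 complex"
  have inj: "\<phi> \<sigma> k = \<phi> \<sigma> l \<longleftrightarrow> k = l" if "bij \<sigma>" for \<sigma> k l
  proof
    assume eq: "\<phi> \<sigma> k = \<phi> \<sigma> l"
    then have "\<And>i. snd k $ \<sigma> i = snd l $ \<sigma> i"
      by (simp add: \<phi>_def Finite_Cartesian_Product.vec_eq_iff)
    then have "\<And>j. snd k $ j = snd l $ j"
      using that by (metis bij_pointE)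
    with eq show "k = l"
      by (simp add: \<phi>_def prod_eq_iff Finite_Cartesian_Product.vec_eq_iff)
  qed simp
  have lookup_L: "Poly_Mapping.lookup (L \<sigma> H) (\<phi> \<sigma> k) = Poly_Mapping.lookup H k" if "bij \<sigma>" for \<sigma> H k
    by (simp add: L_def lookup_sum lookup_single when_def inj[OF that] in_keys_iff)
  have surj: "\<exists>l. k = \<phi> \<sigma> l" if "bij \<sigma>" for \<sigma> k
    by (rule exI[of _ "(fst k, \<chi> i. snd k $ inv_into UNIV \<sigma> i)"])
      (use that in \<open>simp add: \<phi>_def prod_eq_iff Finite_Cartesian_Product.vec_eq_iff bij_is_inj\<close>)
  have inv_iff: "H \<in> O_TxTW \<longleftrightarrow> (\<forall>\<sigma>. bij \<sigma> \<longrightarrow> L \<sigma> H = H)" for H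
  proof -
    have "L \<sigma> H = H \<longleftrightarrow> (\<forall>k. Poly_Mapping.lookup H (\<phi> \<sigma> k) = Poly_Mapping.lookup H k)" if "bij \<sigma>" for \<sigma>
    proof -
      have "L \<sigma> H = H \<longleftrightarrow> (\<forall>k. Poly_Mapping.lookup (L \<sigma> H) k = Poly_Mapping.lookup H k)"
        by (metis poly_mapping_eqI)
      also have "\<dots> \<longleftrightarrow> (\<forall>k. Poly_Mapping.lookup (L \<sigma> H) (\<phi> \<sigma> k) = Poly_Mapping.lookup H (\<phi> \<sigma> k))"
        using surj[OF that] by metis
      finally show ?thesis
        by (auto simp: lookup_L[OF that])
    qed
    then show ?thesis
      by (auto simp: O_TxTW_def \<phi>_def)
  qed
  have "L \<sigma> (F * G) = L \<sigma> F * L \<sigma> G" for \<sigma>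
    unfolding L_def
    by (rule multiplicative_sum_single) (simp_all add: \<phi>_def Finite_Cartesian_Product.vec_eq_iff)
  with assms show ?thesis
    by (simp add: inv_iff)
qed

lemma O_TxTW_const: "Poly_Mapping.single (a, 0) c \<in> O_TxTW"
proof -
  have "(\<chi> i. b $ \<sigma> i) = 0 \<longleftrightarrow> b = 0" if "bij \<sigma>" for \<sigma> :: "'a \<Rightarrow> 'a" and b :: "int ^ 'a"
    using that by (simp add: Finite_Cartesian_Product.vec_eq_iff) (metis bij_pointE)
  then show ?thesis
    by (auto simp: O_TxTW_def lookup_single when_def)
qed

lemma O_TxTW_sum: "(\<And>i. i \<in> I \<Longrightarrow> f i \<in> O_TxTW) \<Longrightarrow> (\<Sum>i\<in>I. f i) \<in> O_TxTW"
  by (simp add: O_TxTW_def lookup_sum)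

lemma power_pullback_right_in:
  fixes h :: "int ^ 'n \<Rightarrow>\<^sub>0 complex"
  assumes "weyl_invariant h"
  shows "power_pullback_right l h \<in> O_TxTW"
proof -
  have "Poly_Mapping.lookup (power_pullback_right l h) (a, \<chi> i. b $ \<sigma> i) =
      Poly_Mapping.lookup (power_pullback_right l h) (a, b)" if \<sigma>: "bij \<sigma>" for \<sigma> :: "'n \<Rightarrow> 'n" and a b
  proof -
    let ?p = "\<lambda>k :: int ^ 'n. \<chi> i. k $ \<sigma> i" and ?p' = "\<lambda>k :: int ^ 'n. \<chi> i. k $ inv_into UNIV \<sigma> i"
    have inv: "?p (?p' k) = k" "?p' (?p k) = k" for k
      using \<sigma> by (simp_all add: Finite_Cartesian_Product.vec_eq_iff bij_is_inj bij_is_surj surj_f_inv_f)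
    have h: "Poly_Mapping.lookup h (?p k) = Poly_Mapping.lookup h k" for k
      using assms \<sigma> unfolding weyl_invariant_def by blast
    have bij: "bij_betw ?p (Poly_Mapping.keys h) (Poly_Mapping.keys h)"
      by (rule bij_betw_byWitness[of _ ?p']) (use h inv in \<open>auto simp: in_keys_iff, metis\<close>)
    have p_mult: "int l *s ?p k = ?p (int l *s k)" for k
      by (simp add: Finite_Cartesian_Product.vec_eq_iff)
    have p_eq: "?p k = ?p k' \<longleftrightarrow> k = k'" for k k'
      using inv(2) by metis
    have "Poly_Mapping.lookup (power_pullback_right l h) (a, ?p b) =
        (\<Sum>k\<in>Poly_Mapping.keys h. Poly_Mapping.lookup h k when (0, int l *s k) = (a, ?p b))"
      by (simp add: power_pullback_right_def lookup_sum lookup_single)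
    also have "\<dots> = (\<Sum>k\<in>Poly_Mapping.keys h. Poly_Mapping.lookup h (?p k) when (0, int l *s ?p k) = (a, ?p b))"
      by (rule sum.reindex_bij_betw[OF bij, symmetric])
    also have "\<dots> = (\<Sum>k\<in>Poly_Mapping.keys h. Poly_Mapping.lookup h k when (0, int l *s k) = (a, b))"
      by (simp only: h p_mult p_eq prod.inject)
    also have "\<dots> = Poly_Mapping.lookup (power_pullback_right l h) (a, b)"
      by (simp add: power_pullback_right_def lookup_sum lookup_single)
    finally show ?thesis .
  qed
  then show ?thesis
    by (simp add: O_TxTW_def)
qed

lemma Z_ideal_subset: "F \<in> Z_ideal l \<Longrightarrow> F \<in> O_TxTW"
proof (induction rule: Z_ideal.induct)
  case (gen h)
  have "power_pullback_left l h \<in> O_TxTW"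
    unfolding power_pullback_left_def by (intro O_TxTW_sum O_TxTW_const)
  with power_pullback_right_in[OF gen] show ?case
    by (simp add: O_TxTW_diff)
qed (simp_all add: O_TxTW_add O_TxTW_mult)

text \<open>
  \<open>gamma d\<close> restricts to the unique ring map from the deformation ring to \<open>O(T \<times> G\<^sub>m)\<close> extending
  the pullback on \<open>O(T \<times> T//W)[q\<^sup>\<plusminus>\<^sup>1]\<close>: see \<open>gamma_one\<close>, \<open>gamma_add\<close>, \<open>gamma_mult\<close> and the two
  theorems below.
\<close>

theorem gamma_deformation_ring: "F \<in> deformation_ring \<Longrightarrow> gamma d F \<in> O_TxGm"
proof (induction rule: deformation_ring.induct)
  case (base F)
  show ?case by (rule gamma_extend_q)
next
  case (q_power k)
  show ?case
    by (simp add: zero_prod_def gamma_single O_TxGm_single laurent_q_qv)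
next
  case (blowup l F)
  then obtain G where "G \<in> O_TxGm" "gamma d (extend_q F) = Poly_Mapping.single 0 (1 - qv ^ l) * G"
    using gamma_Z_ideal by blast
  with one_minus_qv_power_neq_0[OF blowup(1)] show ?case
    by (simp add: gamma_mult zero_prod_def gamma_single Poly_Mapping.mult_single flip: mult.assoc)
next
  case (add F G)
  then show ?case by (simp add: gamma_add O_TxGm_add)
next
  case (mult F G)
  then show ?case by (simp add: gamma_mult O_TxGm_mult)
qed

theorem gamma_unique:
  assumes add: "\<And>F G. F \<in> deformation_ring \<Longrightarrow> G \<in> deformation_ring \<Longrightarrow> g (F + G) = g F + g G"
    and mult: "\<And>F G. F \<in> deformation_ring \<Longrightarrow> G \<in> deformation_ring \<Longrightarrow> g (F * G) = g F * g G"
    and base: "\<And>F. F \<in> O_TxTW \<Longrightarrow> g (extend_q F) = gamma d (extend_q F)"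
    and q_power: "\<And>k. g (Poly_Mapping.single 0 (qv powi k)) = gamma d (Poly_Mapping.single 0 (qv powi k))"
    and F: "F \<in> deformation_ring"
  shows "g F = gamma d F"
  using F
proof induction
  case (blowup l F)
  let ?u = "1 - qv ^ l"
  let ?B = "Poly_Mapping.single 0 (inverse ?u) * extend_q F"
  have u: "?u \<noteq> 0"
    by (rule one_minus_qv_power_neq_0) fact
  have m1: "Poly_Mapping.single 0 (- 1) \<in> (O_TxTW :: ((int ^ 'n) \<times> (int ^ 'n) \<Rightarrow>\<^sub>0 complex) set)"
    by (simp add: zero_prod_def O_TxTW_const)
  have e1: "extend_q 1 = Poly_Mapping.single (0 :: (int ^ 'n) \<times> (int ^ 'n)) 1"
    using extend_q_single[of 0 1] by (simp add: const_q_simps)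
  have em1: "extend_q (Poly_Mapping.single 0 (- 1)) = Poly_Mapping.single (0 :: (int ^ 'n) \<times> (int ^ 'n)) (- 1)"
    by (simp only: extend_q_single const_q_simps)
  have u_eq: "Poly_Mapping.single 0 ?u =
      extend_q 1 + extend_q (Poly_Mapping.single 0 (- 1)) * Poly_Mapping.single 0 (qv powi int l)"
    unfolding e1 em1 Poly_Mapping.mult_single by (simp add: single_diff single_uminus)
  have one: "1 \<in> (O_TxTW :: ((int ^ 'n) \<times> (int ^ 'n) \<Rightarrow>\<^sub>0 complex) set)"
    using O_TxTW_const[of 0 1] by (simp flip: zero_prod_def)
  note b1 = deformation_ring.base[OF one] and b2 = deformation_ring.base[OF m1]
    and b3 = deformation_ring.q_power[of "int l"]
  note b4 = deformation_ring.mult[OF b2 b3]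
  have U: "Poly_Mapping.single 0 ?u \<in> deformation_ring"
    unfolding u_eq by (intro deformation_ring.add b1 b4)
  have gU: "g (Poly_Mapping.single 0 ?u) = gamma d (Poly_Mapping.single 0 ?u)"
    unfolding u_eq add[OF b1 b4] mult[OF b2 b3] base[OF one] base[OF m1] q_power
      gamma_add gamma_mult ..
  have B: "?B \<in> deformation_ring"
    using blowup by (rule deformation_ring.blowup)
  have UB: "Poly_Mapping.single 0 ?u * ?B = extend_q F"
    using u by (simp add: Poly_Mapping.mult_single flip: mult.assoc)
  have "gamma d (Poly_Mapping.single 0 ?u) * g ?B = g (extend_q F)"
    using mult[OF U B] by (simp only: gU UB)
  also have "\<dots> = gamma d (extend_q F)"
    using Z_ideal_subset[OF blowup(2)] by (rule base)
  also have "\<dots> = gamma d (Poly_Mapping.single 0 ?u) * gamma d ?B"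
    by (simp only: UB flip: gamma_mult)
  finally have "Poly_Mapping.single 0 ?u * g ?B = Poly_Mapping.single 0 ?u * gamma d ?B"
    by (simp add: zero_prod_def gamma_single)
  then have "Poly_Mapping.single 0 (inverse ?u) * (Poly_Mapping.single 0 ?u * g ?B) =
      Poly_Mapping.single 0 (inverse ?u) * (Poly_Mapping.single 0 ?u * gamma d ?B)"
    by simp
  with u show ?case
    by (simp add: Poly_Mapping.mult_single flip: mult.assoc)
next
  case (base F)
  then show ?case by (rule assms(3))
next
  case (q_power k)
  show ?case by (rule assms(4))
next
  case (add F G)
  then show ?case by (simp only: assms(1) gamma_add)
next
  case (mult F G)
  then show ?case by (simp only: assms(2) gamma_mult)
qed



section \<open>Lattices and the determinant line bundle\<close>

definition fls_smult :: "complex fls \<Rightarrow> complex fls ^ 'n \<Rightarrow> complex fls ^ 'n" where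
  "fls_smult f v = (\<chi> i. f * v $ i)"

definition std_lattice :: "(complex fls ^ 'n) set" where
  "std_lattice = {v. \<forall>i. v $ i \<in> range fps_to_fls}"

definition t_pow :: "int ^ 'n \<Rightarrow> (complex fls ^ 'n) set" where
  "t_pow d = (\<lambda>v. \<chi> i. fls_X_intpow (d $ i) * v $ i) ` std_lattice"

definition scaled_lattice :: "int \<Rightarrow> (complex fls ^ 'n) set" where
  "scaled_lattice k = fls_smult (fls_X_intpow k) ` std_lattice"

text \<open>The action of \<open>(x, q) \<in> T \<times> G\<^sub>m\<close>, in which \<open>t\<^sup>k e\<^sub>i\<close> has weight \<open>x\<^sub>i q\<^sup>k\<close>.\<close>

definition torus_act :: "complex ^ 'n \<Rightarrow> complex \<Rightarrow> complex fls ^ 'n \<Rightarrow> complex fls ^ 'n" where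
  "torus_act x q v = (\<chi> i. Abs_fls (\<lambda>k. x $ i * q powi k * fls_nth (v $ i) k))"

text \<open>\<open>b 0, \<dots>, b (N - 1)\<close> represent a complex basis of \<open>V / U\<close>.\<close>

definition quotient_basis ::
    "(complex fls ^ 'n) set \<Rightarrow> (complex fls ^ 'n) set \<Rightarrow> nat \<Rightarrow> (nat \<Rightarrow> complex fls ^ 'n) \<Rightarrow> bool"
  where
  "quotient_basis V U N b \<longleftrightarrow>
     (\<forall>j<N. b j \<in> V) \<and>
     (\<forall>v\<in>V. \<exists>c. v - (\<Sum>j<N. fls_smult (fls_const (c j)) (b j)) \<in> U) \<and>
     (\<forall>c. (\<Sum>j<N. fls_smult (fls_const (c j)) (b j)) \<in> U \<longrightarrow> (\<forall>j<N. c j = 0))"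

text \<open>The determinant of the endomorphism of \<open>V / U\<close> induced by \<open>g\<close>.\<close>

definition quotient_det ::
    "(complex fls ^ 'n) set \<Rightarrow> (complex fls ^ 'n) set
      \<Rightarrow> (complex fls ^ 'n \<Rightarrow> complex fls ^ 'n) \<Rightarrow> complex" where
  "quotient_det V U g =
     (THE D. \<exists>N b A. quotient_basis V U N b \<and> A \<in> carrier_mat N N \<and>
        (\<forall>j<N. g (b j) - (\<Sum>i<N. fls_smult (fls_const (index_mat A (i, j))) (b i)) \<in> U) \<and>
        D = Determinant.det A)"

text \<open>
  The scalar by which \<open>(x, q)\<close> acts on the line
  \<open>det(t\<^sup>-\<^sup>m \<Lambda>\<^sub>0 / \<Lambda>) \<otimes> det(t\<^sup>-\<^sup>m \<Lambda>\<^sub>0 / \<Lambda>\<^sub>0)\<^sup>-\<^sup>1\<close>, for a torus-fixed lattice \<open>\<Lambda>\<close>.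
\<close>

definition det_fibre_character ::
    "nat \<Rightarrow> (complex fls ^ 'n) set \<Rightarrow> complex ^ 'n \<Rightarrow> complex \<Rightarrow> complex" where
  "det_fibre_character m L x q =
     quotient_det (scaled_lattice (- int m)) L (torus_act x q) /
     quotient_det (scaled_lattice (- int m)) std_lattice (torus_act x q)"

text \<open>
  The class in \<open>K(pt) = R(T \<times> G\<^sub>m) \<otimes> complex = O(T \<times> G\<^sub>m)\<close> of the one-dimensional
  representation on which \<open>(x, q)\<close> acts by \<open>\<phi> x q\<close>.
\<close>

definition character_class ::
    "(complex ^ 'n \<Rightarrow> complex \<Rightarrow> complex) \<Rightarrow> (int ^ 'n \<Rightarrow>\<^sub>0 complex poly fract)" where
  "character_class \<phi> =
     (THE c. \<exists>a k.
        (\<forall>x q. (\<forall>i. x $ i \<noteq> 0) \<and> q \<noteq> 0 \<longrightarrow> \<phi> x q = (\<Prod>i\<in>UNIV. x $ i powi a $ i) * q powi k) \<and>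
        c = Poly_Mapping.single a (qv powi k))"

text \<open>The character does not depend on the choice of \<open>m\<close>.\<close>

definition Ldet_restriction :: "(complex fls ^ 'n) set \<Rightarrow> (int ^ 'n \<Rightarrow>\<^sub>0 complex poly fract)" where
  "Ldet_restriction L =
     character_class
       (det_fibre_character
         (SOME m. scaled_lattice (int m) \<subseteq> L \<and> L \<subseteq> scaled_lattice (- int m)) L)"

end

theory Submission
  imports Defs
begin

text \<open>
  The obstruction is the set of torus weights that can occur.  An element \<open>f\<close> of the deformation
  ring is a finite sum of terms \<open>c(q) x\<^sup>a y\<^sup>b\<close>, and the substitution \<open>y\<^sub>i = q ^ d\<^sub>i x\<^sub>i\<close> turns such a
  term into a multiple of \<open>x\<^sup>a\<^sup>+\<^sup>b\<close> by a function of \<open>q\<close>.  The cocharacter \<open>d\<close> enters only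
  through that function, so one finite set of characters of \<open>T\<close> supports all the restrictions
  \<open>gamma d f\<close> at once (\<open>keys_gamma\<close>).

  The determinant line bundle, on the other hand, has weight
  \<open>x\<^sup>d q ^ (\<Sum>i. d\<^sub>i (d\<^sub>i - 1) / 2)\<close> at the fixed point \<open>t\<^sup>d\<close> (\<open>Ldet_restriction_t_pow\<close>), so
  its restrictions involve every character of \<open>T\<close>, of which there are infinitely many.

  Most of the work lies in that weight.  The quotient \<open>t\<^sup>-\<^sup>m \<Lambda>\<^sub>0 / t\<^sup>d \<Lambda>\<^sub>0\<close> has the weight basis
  \<open>t\<^sup>k e\<^sub>i\<close> with \<open>-m \<le> k < d\<^sub>i\<close>, whose determinant is the product of the weights \<open>x\<^sub>i q\<^sup>k\<close>
  (\<open>quotient_det_t_pow\<close>).  The factors with \<open>k < 0\<close> cancel against \<open>t\<^sup>-\<^sup>m \<Lambda>\<^sub>0 / \<Lambda>\<^sub>0\<close>, up to the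
  correction for negative \<open>d\<^sub>i\<close>, and the exponents sum to binomial coefficients
  (\<open>prod_weights_shift\<close>).  The determinant on the quotient, the line bundle and the class of a
  character are all given by descriptions or choices, so each value also needs an argument that it
  does not depend on the choice: of a basis (\<open>det_independent_of_basis\<close>), of the exponents of a
  character (\<open>character_class_eqI\<close>) and of \<open>m\<close>.
\<close>

section \<open>Determinants of endomorphisms of a quotient space\<close>

locale linear_quotient = vector_space scale
  for scale :: "'k::field_char_0 \<Rightarrow> 'v::ab_group_add \<Rightarrow> 'v" +
  fixes U :: "'v set"
  assumes subspace_U: "subspace U"
begin

text \<open>
  The vectors \<open>b 0, \<dots>, b (N - 1)\<close> represent a basis of \<open>V / U\<close>; working with representatives
  and congruences modulo \<open>U\<close> avoids a quotient type that would depend on \<open>U\<close>.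
\<close>

definition basis_modulo :: "'v set \<Rightarrow> nat \<Rightarrow> (nat \<Rightarrow> 'v) \<Rightarrow> bool" where
  "basis_modulo V N b \<longleftrightarrow>
     (\<forall>j<N. b j \<in> V) \<and>
     (\<forall>v\<in>V. \<exists>c. v - (\<Sum>j<N. scale (c j) (b j)) \<in> U) \<and>
     (\<forall>c. (\<Sum>j<N. scale (c j) (b j)) \<in> U \<longrightarrow> (\<forall>j<N. c j = 0))"

lemma cong_sym: "u - v \<in> U \<Longrightarrow> v - u \<in> U"
  using subspace_neg[OF subspace_U, of "u - v"] by simp

lemma cong_trans: "u - v \<in> U \<Longrightarrow> v - w \<in> U \<Longrightarrow> u - w \<in> U"
  using subspace_add[OF subspace_U, of "u - v" "v - w"] by simp

lemma combination_substitute: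
  assumes "\<And>j. j < M \<Longrightarrow> w j - (\<Sum>i<N. scale (P i j) (b i)) \<in> U"
  shows "(\<Sum>j<M. scale (c j) (w j)) - (\<Sum>i<N. scale (\<Sum>j<M. P i j * c j) (b i)) \<in> U"
proof -
  have "(\<Sum>j<M. scale (c j) (\<Sum>i<N. scale (P i j) (b i))) =
      (\<Sum>i<N. scale (\<Sum>j<M. P i j * c j) (b i))"
    by (simp add: scale_sum_right scale_sum_left mult.commute) (rule sum.swap)
  then have "(\<Sum>j<M. scale (c j) (w j)) - (\<Sum>i<N. scale (\<Sum>j<M. P i j * c j) (b i)) =
      (\<Sum>j<M. scale (c j) (w j - (\<Sum>i<N. scale (P i j) (b i))))"
    by (simp add: scale_right_diff_distrib sum_subtractf)
  also have "\<dots> \<in> U"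
    using assms by (intro subspace_sum[OF subspace_U] subspace_scale[OF subspace_U]) simp
  finally show ?thesis .
qed

text \<open>
  Two expansions of one vector modulo \<open>U\<close> have equal coefficients.  This is how congruences
  modulo \<open>U\<close> are converted into identities between matrix entries below.
\<close>

lemma coefficients_unique:
  assumes "basis_modulo V N b"
    and "v - (\<Sum>i<N. scale (c i) (b i)) \<in> U" "v - (\<Sum>i<N. scale (e i) (b i)) \<in> U"
    and "i < N"
  shows "c i = e i"
proof -
  have "(\<Sum>i<N. scale (c i) (b i)) - (\<Sum>i<N. scale (e i) (b i)) \<in> U"
    using assms(2,3) cong_sym cong_trans by blast
  then have "(\<Sum>i<N. scale (c i - e i) (b i)) \<in> U"
    by (simp add: scale_left_diff_distrib sum_subtractf)
  with assms(1) have "\<forall>i<N. c i - e i = 0"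
    unfolding basis_modulo_def by (elim conjE allE[of _ "\<lambda>i. c i - e i"]) blast
  with assms(4) show ?thesis by simp
qed

lemma change_of_basis:
  assumes "basis_modulo V N b" "\<And>j. j < M \<Longrightarrow> w j \<in> V"
  obtains P where "\<And>j. j < M \<Longrightarrow> w j - (\<Sum>i<N. scale (P i j) (b i)) \<in> U"
proof -
  have "\<forall>j. \<exists>p. j < M \<longrightarrow> w j - (\<Sum>i<N. scale (p i) (b i)) \<in> U"
    using assms unfolding basis_modulo_def by meson
  then obtain p where "\<forall>j. j < M \<longrightarrow> w j - (\<Sum>i<N. scale (p j i) (b i)) \<in> U"
    by metis
  then show ?thesis
    by (intro that[of "\<lambda>i j. p j i"]) blast
qed

lemma transition_inverse:
  assumes b: "basis_modulo V N b"
    and P: "\<And>j. j < M \<Longrightarrow> w j - (\<Sum>i<N. scale (P i j) (b i)) \<in> U"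
    and Q: "\<And>j. j < N \<Longrightarrow> b j - (\<Sum>i<M. scale (Q i j) (w i)) \<in> U"
    and "i < N" "j < N"
  shows "(\<Sum>k<M. P i k * Q k j) = (if i = j then 1 else 0)"
proof (rule coefficients_unique[OF b, where v = "b j" and i = i
      and c = "\<lambda>i. \<Sum>k<M. P i k * Q k j" and e = "\<lambda>i. if i = j then 1 else 0"])
  show "b j - (\<Sum>i<N. scale (\<Sum>k<M. P i k * Q k j) (b i)) \<in> U"
    by (rule cong_trans[OF Q[OF \<open>j < N\<close>] combination_substitute[OF P]])
  have "(\<Sum>i<N. scale (if i = j then 1 else 0) (b i)) = (\<Sum>i<N. if i = j then b i else 0)"
    by (rule sum.cong) auto
  then show "b j - (\<Sum>i<N. scale (if i = j then 1 else 0) (b i)) \<in> U"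
    using \<open>j < N\<close> by (simp add: subspace_0[OF subspace_U])
qed fact

text \<open>
  For mutually inverse transition matrices \<open>P\<close> and \<open>Q\<close>, the traces of \<open>P Q\<close> and \<open>Q P\<close> agree,
  and they are the two cardinalities; in characteristic zero this decides the dimension.
\<close>

lemma basis_modulo_card_unique:
  assumes b: "basis_modulo V N b" and w: "basis_modulo V M w"
  shows "N = M"
proof -
  obtain P where P: "\<And>j. j < M \<Longrightarrow> w j - (\<Sum>i<N. scale (P i j) (b i)) \<in> U"
    using change_of_basis[OF b, of M w] w by (auto simp: basis_modulo_def)
  obtain Q where Q: "\<And>j. j < N \<Longrightarrow> b j - (\<Sum>i<M. scale (Q i j) (w i)) \<in> U"
    using change_of_basis[OF w, of N b] b by (auto simp: basis_modulo_def)
  have "(of_nat N :: 'k) = (\<Sum>i<N. \<Sum>k<M. P i k * Q k i)"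
    using transition_inverse[OF b P Q] by simp
  also have "\<dots> = (\<Sum>k<M. \<Sum>i<N. Q k i * P i k)"
    by (subst sum.swap) (simp add: mult.commute)
  also have "\<dots> = of_nat M"
    using transition_inverse[OF w Q P] by simp
  finally show ?thesis by simp
qed

text \<open>
  Expanding \<open>g\<close> of the second basis in the first one in two ways gives \<open>A P = P B\<close> for the
  invertible transition matrix \<open>P\<close>.
\<close>

lemma det_independent_of_basis:
  assumes b: "basis_modulo V N b" and w: "basis_modulo V M w"
    and A: "A \<in> carrier_mat N N" and B: "B \<in> carrier_mat M M"
    and gb: "\<And>j. j < N \<Longrightarrow> g (b j) - (\<Sum>i<N. scale (index_mat A (i, j)) (b i)) \<in> U"
    and gw: "\<And>j. j < M \<Longrightarrow> g (w j) - (\<Sum>i<M. scale (index_mat B (i, j)) (w i)) \<in> U"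
    and g: "module_hom scale scale g" and gU: "\<And>u. u \<in> U \<Longrightarrow> g u \<in> U"
  shows "Determinant.det A = Determinant.det B"
proof -
  interpret g: module_hom scale scale g by fact
  have MN: "M = N"
    using basis_modulo_card_unique[OF w b] .
  obtain P where P: "\<And>j. j < N \<Longrightarrow> w j - (\<Sum>i<N. scale (P i j) (b i)) \<in> U"
    using change_of_basis[OF b, of M w] w by (auto simp: basis_modulo_def MN)
  obtain Q where Q: "\<And>j. j < N \<Longrightarrow> b j - (\<Sum>i<N. scale (Q i j) (w i)) \<in> U"
    using change_of_basis[OF w, of N b] b by (auto simp: basis_modulo_def MN)
  define PM where "PM = Matrix.mat N N (\<lambda>(i, j). P i j)"
  define QM where "QM = Matrix.mat N N (\<lambda>(i, j). Q i j)"
  have PM: "PM \<in> carrier_mat N N" and QM: "QM \<in> carrier_mat N N"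
    by (simp_all add: PM_def QM_def)
  have dims: "dim_row A = N" "dim_col A = N" "dim_row B = N" "dim_col B = N"
    using A B MN by auto
  have "PM * QM = 1\<^sub>m N"
    by (rule eq_matI)
      (use transition_inverse[OF b P Q] in
        \<open>auto simp: PM_def QM_def scalar_prod_def lessThan_atLeast0\<close>)
  then have "Determinant.det PM * Determinant.det QM = 1"
    using det_mult[OF PM QM] by simp
  then have det_PM: "Determinant.det PM \<noteq> 0"
    by auto
  have entries: "(\<Sum>k<N. index_mat A (i, k) * P k j) = (\<Sum>k<N. P i k * index_mat B (k, j))"
    if "i < N" "j < N" for i j
  proof (rule coefficients_unique[OF b, where v = "g (w j)" and i = i
        and c = "\<lambda>i. \<Sum>k<N. index_mat A (i, k) * P k j"
        and e = "\<lambda>i. \<Sum>k<N. P i k * index_mat B (k, j)"])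
    have "g (w j - (\<Sum>i<N. scale (P i j) (b i))) \<in> U"
      using P[OF \<open>j < N\<close>] by (rule gU)
    then have "g (w j) - (\<Sum>i<N. scale (P i j) (g (b i))) \<in> U"
      by (simp add: g.diff g.sum g.scale)
    then show "g (w j) - (\<Sum>i<N. scale (\<Sum>k<N. index_mat A (i, k) * P k j) (b i)) \<in> U"
      by (rule cong_trans[OF _ combination_substitute[OF gb]])
    show "g (w j) - (\<Sum>i<N. scale (\<Sum>k<N. P i k * index_mat B (k, j)) (b i)) \<in> U"
      using gw[of j] \<open>j < N\<close> unfolding MN by (intro cong_trans[OF _ combination_substitute[OF P]])
  qed fact
  have "A * PM = PM * B"
    by (rule eq_matI)
      (use entries dims in \<open>auto simp: PM_def scalar_prod_def lessThan_atLeast0\<close>)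
  then have "Determinant.det A * Determinant.det PM = Determinant.det PM * Determinant.det B"
    using det_mult[OF A PM] det_mult[OF PM] B MN by metis
  with det_PM show ?thesis
    by simp
qed

end


section \<open>The lattices fixed by the torus\<close>

lemma range_fps_to_fls: "f \<in> range fps_to_fls \<longleftrightarrow> (\<forall>n<0. fls_nth f n = 0)"
proof
  assume "\<forall>n<0. fls_nth f n = 0"
  then have "f = fps_to_fls (fls_regpart f)"
    by (intro fls_eqI) simp
  then show "f \<in> range fps_to_fls" by (rule range_eqI)
qed auto

lemma in_t_pow_iff: "v \<in> t_pow d \<longleftrightarrow> (\<forall>i. \<forall>n < d $ i. fls_nth (v $ i) n = 0)"
proof
  assume "v \<in> t_pow d"
  then show "\<forall>i. \<forall>n < d $ i. fls_nth (v $ i) n = 0"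
    by (auto simp: t_pow_def std_lattice_def range_fps_to_fls fls_X_intpow_times_conv_shift)
next
  assume v: "\<forall>i. \<forall>n < d $ i. fls_nth (v $ i) n = 0"
  let ?w = "\<chi> i. fls_shift (d $ i) (v $ i)"
  have "?w \<in> std_lattice"
    using v by (auto simp: std_lattice_def range_fps_to_fls)
  moreover have "v = (\<chi> i. fls_X_intpow (d $ i) * ?w $ i)"
    by (simp add: Finite_Cartesian_Product.vec_eq_iff fls_X_intpow_times_conv_shift)
  ultimately show "v \<in> t_pow d"
    unfolding t_pow_def by (rule rev_image_eqI)
qed

lemma std_lattice_eq_t_pow: "std_lattice = t_pow 0"
  by (auto simp: in_t_pow_iff std_lattice_def range_fps_to_fls)

lemma scaled_lattice_eq_t_pow: "scaled_lattice k = t_pow (\<chi> i. k)"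
  by (simp add: scaled_lattice_def t_pow_def fls_smult_def[abs_def])

text \<open>
  The vector with entries \<open>t ^ d\<^sub>i\<close> lies in \<open>t\<^sup>d \<Lambda>\<^sub>0\<close> and attains its bound on the order of vanishing
  in every coordinate, so it tests the inclusion.
\<close>

lemma t_pow_subset_iff: "t_pow d \<subseteq> t_pow e \<longleftrightarrow> (\<forall>i. e $ i \<le> d $ i)"
proof
  assume sub: "t_pow d \<subseteq> t_pow e"
  have "(\<chi> i. fls_X_intpow (d $ i)) \<in> t_pow d"
    by (simp add: in_t_pow_iff)
  with sub have "(\<chi> i. fls_X_intpow (d $ i)) \<in> t_pow e"
    by blast
  then have "fls_nth (fls_X_intpow (d $ i) :: complex fls) (d $ i) = 0" if "d $ i < e $ i" for i
    using that unfolding in_t_pow_iff vec_lambda_beta by blast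
  then show "\<forall>i. e $ i \<le> d $ i"
    by (metis diff_self fls_shift_nth fls_one_nth add.right_inverse not_less zero_neq_one)
next
  assume "\<forall>i. e $ i \<le> d $ i"
  then show "t_pow d \<subseteq> t_pow e"
    unfolding in_t_pow_iff subset_iff by (meson less_le_trans)
qed

text \<open>
  Rescaling the coefficients keeps the pole order bounded, so the coefficient function
  in the definition of the action is that of a Laurent series.
\<close>

lemma fls_nth_torus_act:
  "fls_nth (torus_act x q v $ i) k = x $ i * q powi k * fls_nth (v $ i) k"
proof -
  have "\<forall>n < fls_subdegree (v $ i). x $ i * q powi n * fls_nth (v $ i) n = 0"
    by simp
  from nth_Abs_fls_lower_bound[OF this] show ?thesis
    by (simp add: torus_act_def)
qed

lemma fls_nth_sum: "fls_nth (\<Sum>j\<in>J. f j) k = (\<Sum>j\<in>J. fls_nth (f j) k)"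
  by (induction J rule: infinite_finite_induct) simp_all

lemma fls_nth_smult_const: "fls_nth (fls_smult (fls_const c) v $ i) k = c * fls_nth (v $ i) k"
  by (simp add: fls_smult_def)

lemma vec_fls_eq_iff:
  fixes v w :: "'a::zero fls ^ 'n"
  shows "v = w \<longleftrightarrow> (\<forall>i k. fls_nth (v $ i) k = fls_nth (w $ i) k)"
  by (auto simp: Finite_Cartesian_Product.vec_eq_iff fls_eq_iff)

interpretation fls_vec: vector_space "\<lambda>c. fls_smult (fls_const c)"
  by unfold_locales (simp_all add: vec_fls_eq_iff fls_smult_def algebra_simps)

lemma linear_quotient_t_pow: "linear_quotient (\<lambda>c. fls_smult (fls_const c)) (t_pow d)"
  by unfold_locales
    (simp add: fls_vec.subspace_def in_t_pow_iff fls_nth_smult_const)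

lemma module_hom_torus_act:
  "module_hom (\<lambda>c. fls_smult (fls_const c)) (\<lambda>c. fls_smult (fls_const c)) (torus_act x q)"
  by (intro module_hom.intro module_hom_axioms.intro fls_vec.module_axioms)
    (simp_all add: vec_fls_eq_iff fls_nth_torus_act fls_nth_smult_const algebra_simps)

text \<open>
  The lattice \<open>t\<^sup>d \<Lambda>\<^sub>0\<close> is stable under the torus, so any single basis of the quotient computes the
  determinant.
\<close>

lemma quotient_det_t_pow_eqI:
  assumes "quotient_basis V (t_pow d) N b" "A \<in> carrier_mat N N"
    and "\<forall>j<N. torus_act x q (b j) -
      (\<Sum>i<N. fls_smult (fls_const (index_mat A (i, j))) (b i)) \<in> t_pow d"
  shows "quotient_det V (t_pow d) (torus_act x q) = Determinant.det A"
  unfolding quotient_det_def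
proof (rule the_equality)
  interpret Q: linear_quotient "\<lambda>c. fls_smult (fls_const c)" "t_pow d"
    by (rule linear_quotient_t_pow)
  have basis: "quotient_basis V (t_pow d) M w \<longleftrightarrow> Q.basis_modulo V M w" for M w
    by (simp add: quotient_basis_def Q.basis_modulo_def)
  have stable: "torus_act x q u \<in> t_pow d" if "u \<in> t_pow d" for u
    using that by (simp add: in_t_pow_iff fls_nth_torus_act)
  show "D = Determinant.det A"
    if "\<exists>M w B. quotient_basis V (t_pow d) M w \<and> B \<in> carrier_mat M M \<and>
      (\<forall>j<M. torus_act x q (w j) -
        (\<Sum>i<M. fls_smult (fls_const (index_mat B (i, j))) (w i)) \<in> t_pow d) \<and>
      D = Determinant.det B" for D
    using that assms Q.det_independent_of_basis[OF _ _ _ _ _ _ module_hom_torus_act stable]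
    unfolding basis by blast
qed (use assms in blast)

text \<open>
  For \<open>e \<le> d\<close> the monomials \<open>t\<^sup>k e\<^sub>i\<close> with \<open>e\<^sub>i \<le> k < d\<^sub>i\<close> are a basis of \<open>t\<^sup>e \<Lambda>\<^sub>0 / t\<^sup>d \<Lambda>\<^sub>0\<close>
  consisting of weight vectors, so the determinant is the product of their weights.
\<close>

lemma quotient_det_t_pow:
  fixes d e :: "int ^ 'n"
  assumes le: "\<And>i. e $ i \<le> d $ i"
  shows "quotient_det (t_pow e) (t_pow d) (torus_act x q) =
    (\<Prod>i\<in>UNIV. \<Prod>k\<in>{e $ i..<d $ i}. x $ i * q powi k)"
proof -
  define S where "S = (SIGMA i:UNIV. {e $ i..<d $ i})"
  have "finite S"
    by (simp add: S_def)
  then obtain h where h: "bij_betw h {..<card S} S"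
    by (metis lessThan_atLeast0 ex_bij_betw_nat_finite)
  define N where "N = card S"
  note h = h[folded N_def]
  have h_onto: "h ` {..<N} = S"
    using h by (rule bij_betw_imp_surj_on)
  define wt where "wt = (\<lambda>(i, k). x $ i * q powi k)"
  \<comment> \<open>the monomial \<open>t\<^sup>k e\<^sub>i\<close> for \<open>h j = (i, k)\<close>\<close>
  define b :: "nat \<Rightarrow> complex fls ^ 'n"
    where "b j = (\<chi> i. if i = fst (h j) then fls_X_intpow (snd (h j)) else 0)" for j
  have b: "fls_nth (b j $ i) k = (if h j = (i, k) then 1 else 0)" for i j k
    by (cases "h j") (auto simp: b_def)
  have lin: "fls_nth (\<Sum>j<N. fls_smult (fls_const (c j)) (b j) $ i) k =
      (\<Sum>j<N. if h j = (i, k) then c j else 0)" for c i k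
    by (simp add: fls_nth_sum fls_nth_smult_const b if_distrib cong: if_cong)
  have lin_h: "(\<Sum>j<N. if h j = h j' then c j else 0) = c j'" if "j' < N" for c :: "nat \<Rightarrow> complex" and j'
  proof -
    have "(\<Sum>j<N. if h j = h j' then c j else 0) = (\<Sum>j<N. if j = j' then c j else 0)"
      using h that by (intro sum.cong) (auto simp: bij_betw_def inj_on_def)
    with that show ?thesis by simp
  qed
  have basis: "quotient_basis (t_pow e) (t_pow d) N b"
    unfolding quotient_basis_def
  proof (intro conjI allI impI ballI)
    fix j assume "j < N"
    then have "h j \<in> S" using h_onto by blast
    then show "b j \<in> t_pow e"
      by (auto simp: in_t_pow_iff b S_def)
  next
    fix v assume v: "v \<in> t_pow e"
    \<comment> \<open>Modulo \<open>t\<^sup>d \<Lambda>\<^sub>0\<close> a vector is determined by its coefficients at the indices in \<open>S\<close>.\<close>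
    define c where "c j = fls_nth (v $ fst (h j)) (snd (h j))" for j
    have "fls_nth (v $ i) k = (\<Sum>j<N. if h j = (i, k) then c j else 0)" if "k < d $ i" for i k
    proof (cases "e $ i \<le> k")
      case True
      with that have "(i, k) \<in> h ` {..<N}"
        by (simp add: h_onto S_def)
      then obtain j where "j < N" "h j = (i, k)"
        by auto
      then show ?thesis
        using lin_h[of j c] by (simp add: c_def)
    next
      case False
      then have "(i, k) \<notin> h ` {..<N}"
        by (simp add: h_onto S_def)
      then have "h j \<noteq> (i, k)" if "j < N" for j
        using that by (metis imageI lessThan_iff)
      with False v show ?thesis
        by (simp add: in_t_pow_iff)
    qed
    then have "v - (\<Sum>j<N. fls_smult (fls_const (c j)) (b j)) \<in> t_pow d"
      by (simp add: in_t_pow_iff lin)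
    then show "\<exists>c. v - (\<Sum>j<N. fls_smult (fls_const (c j)) (b j)) \<in> t_pow d"
      by blast
  next
    fix c j assume c: "(\<Sum>j<N. fls_smult (fls_const (c j)) (b j)) \<in> t_pow d" and j: "j < N"
    obtain i k where ik: "h j = (i, k)" by fastforce
    have "h j \<in> S"
      using j h_onto by blast
    with ik have "k < d $ i"
      by (simp add: S_def)
    with c have "(\<Sum>j<N. if h j = (i, k) then c j else 0) = 0"
      by (simp add: in_t_pow_iff lin)
    with lin_h[OF j, of c] ik show "c j = 0" by simp
  qed
  define A where "A = Matrix.mat N N (\<lambda>(i, j). if i = j then wt (h j) else 0)"
  have "torus_act x q (b j) = (\<Sum>i<N. fls_smult (fls_const (index_mat A (i, j))) (b i))"
    if "j < N" for j
  proof -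
    have "fls_smult (fls_const (index_mat A (i, j))) (b i) =
        (if i = j then fls_smult (fls_const (wt (h j))) (b j) else 0)" if "i < N" for i
      using that \<open>j < N\<close>
      by (simp add: A_def) (simp add: fls_smult_def Finite_Cartesian_Product.vec_eq_iff)
    then have "(\<Sum>i<N. fls_smult (fls_const (index_mat A (i, j))) (b i)) =
        fls_smult (fls_const (wt (h j))) (b j)"
      using \<open>j < N\<close> by simp
    then show ?thesis
      by (simp add: vec_fls_eq_iff fls_nth_torus_act fls_nth_smult_const b wt_def)
  qed
  then have "quotient_det (t_pow e) (t_pow d) (torus_act x q) = Determinant.det A"
    by (intro quotient_det_t_pow_eqI[OF basis]) (simp_all add: A_def in_t_pow_iff)
  also have "\<dots> = (\<Prod>j<N. wt (h j))"
    by (subst det_upper_triangular[of _ N])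
      (auto simp: A_def upper_triangular_def prod_list_diag_prod lessThan_atLeast0)
  also have "\<dots> = (\<Prod>s\<in>S. wt s)"
    using h by (rule prod.reindex_bij_betw)
  also have "\<dots> = (\<Prod>i\<in>UNIV. \<Prod>k\<in>{e $ i..<d $ i}. x $ i * q powi k)"
    by (simp add: S_def wt_def prod.Sigma)
  finally show ?thesis .
qed


section \<open>Fixed-point restrictions of the determinant line bundle\<close>

text \<open>
  Since \<open>\<Sum>k = 0..<e. k = e (e - 1) / 2\<close>, the weights with \<open>0 \<le> k < e\<close> multiply to
  \<open>y\<^sup>e q ^ (e (e - 1) / 2)\<close>.  The same monomial corrects for the missing weights \<open>e \<le> k < 0\<close>
  when \<open>e\<close> is negative: the induction starts at \<open>e = m\<close>, where the left side is \<open>1\<close>, and this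
  base case is a downward induction on \<open>m\<close>.
\<close>

lemma prod_weights_shift:
  fixes y q :: "'a::field"
  assumes "y \<noteq> 0" "q \<noteq> 0" "m \<le> 0" "m \<le> e"
  shows "(\<Prod>k\<in>{m..<e}. y * q powi k) =
    (\<Prod>k\<in>{m..<0}. y * q powi k) * (y powi e * q powi (e * (e - 1) div 2))"
  using \<open>m \<le> e\<close>
proof (induction e rule: int_ge_induct)
  case base
  show ?case
    using \<open>m \<le> 0\<close>
  proof (induction m rule: int_le_induct)
    case (step m)
    define P where "P = (\<Prod>k\<in>{m..<0}. y * q powi k)"
    define s where "s = m * (m - 1) div 2"
    have "{m - 1..<0} = insert (m - 1) {m..<0}"
      using step.hyps by auto
    then have P: "(\<Prod>k\<in>{m - 1..<0}. y * q powi k) = y * q powi (m - 1) * P"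
      by (simp add: P_def)
    have "(m - 1) * (m - 1 - 1) = m * (m - 1) + (1 - m) * 2"
      by (simp add: algebra_simps)
    then have s: "(m - 1) * (m - 1 - 1) div 2 = s + (1 - m)"
      by (simp add: s_def)
    have y: "y * y powi (m - 1) = y powi m"
      using power_int_add[of y 1 "m - 1"] assms(1) by simp
    have q: "q powi (m - 1) * q powi (s + (1 - m)) = q powi s"
      using power_int_add[of q "m - 1" "s + (1 - m)"] assms(2) by simp
    have "(\<Prod>k\<in>{m - 1..<0}. y * q powi k) *
        (y powi (m - 1) * q powi ((m - 1) * (m - 1 - 1) div 2)) =
        P * ((y * y powi (m - 1)) * (q powi (m - 1) * q powi (s + (1 - m))))"
      unfolding P s by (simp only: ac_simps)
    also have "\<dots> = (\<Prod>k\<in>{m..<m}. y * q powi k)"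
      unfolding y q unfolding P_def s_def by (rule step.IH[symmetric])
    finally show ?case by simp
  qed simp
next
  case (step e)
  have "{m..<e + 1} = insert e {m..<e}"
    using step.hyps by auto
  moreover have "(e + 1) * (e + 1 - 1) = e * (e - 1) + e * 2"
    by (simp add: algebra_simps)
  then have "(e + 1) * (e + 1 - 1) div 2 = e * (e - 1) div 2 + e"
    by simp
  ultimately show ?case
    using step.IH assms(1,2) by (simp add: power_int_add)
qed

lemma prod_power_int: "(\<Prod>i\<in>I. q powi f i) = q powi (\<Sum>i\<in>I. f i)" if "q \<noteq> 0" for q :: "'a::field"
  by (induction I rule: infinite_finite_induct) (simp_all add: power_int_add that)

lemma det_fibre_character_t_pow:
  fixes d :: "int ^ 'n"
  assumes m: "\<And>i. - int m \<le> d $ i" and x: "\<And>i. x $ i \<noteq> 0" and q: "q \<noteq> 0"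
  shows "det_fibre_character m (t_pow d) x q =
    (\<Prod>i\<in>UNIV. x $ i powi d $ i) * q powi (\<Sum>i\<in>UNIV. d $ i * (d $ i - 1) div 2)"
proof -
  define w where "w i = (\<Prod>k\<in>{- int m..<0}. x $ i * q powi k)" for i
  have "(\<Prod>k\<in>{- int m..<d $ i}. x $ i * q powi k) =
      w i * (x $ i powi d $ i * q powi (d $ i * (d $ i - 1) div 2))" for i
    unfolding w_def using m by (intro prod_weights_shift x q) simp_all
  then have "quotient_det (scaled_lattice (- int m)) (t_pow d) (torus_act x q) =
      (\<Prod>i\<in>UNIV. w i) *
      ((\<Prod>i\<in>UNIV. x $ i powi d $ i) * q powi (\<Sum>i\<in>UNIV. d $ i * (d $ i - 1) div 2))"
    using m by (simp add: scaled_lattice_eq_t_pow quotient_det_t_pow prod.distrib prod_power_int q)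
  moreover have "quotient_det (scaled_lattice (- int m)) std_lattice (torus_act x q) =
      (\<Prod>i\<in>UNIV. w i)"
    unfolding scaled_lattice_eq_t_pow std_lattice_eq_t_pow w_def
    by (subst quotient_det_t_pow) simp_all
  moreover have "(\<Prod>i\<in>UNIV. w i) \<noteq> 0"
    using x q by (simp add: w_def)
  ultimately show ?thesis
    by (simp add: det_fibre_character_def)
qed

lemma power_int_2_inject: "(2 :: complex) powi a = 2 powi b \<Longrightarrow> a = b"
proof -
  assume "(2 :: complex) powi a = 2 powi b"
  then have "(2 :: real) powi a = 2 powi b"
    by (metis norm_numeral norm_power_int)
  then show "a = b"
    by (metis linorder_neq_iff one_less_numeral_iff power_int_strict_increasing semiring_norm(76))
qed

text \<open>
  The exponents of a character are recovered from its values where one of the coordinates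
  \<open>x\<^sub>1, \<dots>, x\<^sub>n, q\<close> is \<open>2\<close> and the others are \<open>1\<close>, because \<open>2\<close> is not a root of unity.
\<close>

lemma character_class_eqI:
  fixes a :: "int ^ 'n"
  assumes \<phi>: "\<And>x q. (\<And>i. x $ i \<noteq> 0) \<Longrightarrow> q \<noteq> 0 \<Longrightarrow>
    \<phi> x q = (\<Prod>i\<in>UNIV. x $ i powi a $ i) * q powi k"
  shows "character_class \<phi> = Poly_Mapping.single a (qv powi k)"
  unfolding character_class_def
proof (rule the_equality)
  fix c
  assume "\<exists>a' k'. (\<forall>x q. (\<forall>i. x $ i \<noteq> 0) \<and> q \<noteq> 0 \<longrightarrow>
      \<phi> x q = (\<Prod>i\<in>UNIV. x $ i powi a' $ i) * q powi k') \<and> c = Poly_Mapping.single a' (qv powi k')"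
  then obtain a' k' where \<phi>': "\<And>x q. (\<And>i. x $ i \<noteq> 0) \<Longrightarrow> q \<noteq> 0 \<Longrightarrow>
      \<phi> x q = (\<Prod>i\<in>UNIV. x $ i powi a' $ i) * q powi k'"
    and c: "c = Poly_Mapping.single a' (qv powi k')"
    by blast
  have "a' $ j = a $ j" for j
  proof -
    let ?x = "(\<chi> i. if i = j then 2 else 1) :: complex ^ 'n"
    have x: "(\<Prod>i\<in>UNIV. ?x $ i powi b $ i) = 2 powi b $ j" for b :: "int ^ 'n"
    proof -
      have "(\<Prod>i\<in>UNIV. ?x $ i powi b $ i) = (\<Prod>i\<in>UNIV. if i = j then 2 powi b $ i else 1)"
        by (intro prod.cong) auto
      then show ?thesis by simp
    qed
    have "?x $ i \<noteq> 0" for i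
      by simp
    then show ?thesis
      using \<phi>[of ?x 1] \<phi>'[of ?x 1]
      by (intro power_int_2_inject) (simp add: x del: vec_lambda_beta)
  qed
  moreover have "k' = k"
    using \<phi>[of "\<chi> i. 1" 2] \<phi>'[of "\<chi> i. 1" 2] by (intro power_int_2_inject) simp
  ultimately have "a' = a" "k' = k"
    by (simp_all add: Finite_Cartesian_Product.vec_eq_iff)
  then show "c = Poly_Mapping.single a (qv powi k)"
    by (simp add: c)
qed (use \<phi> in blast)

text \<open>
  Every \<open>m \<ge> \<bar>d\<^sub>i\<bar>\<close> for all \<open>i\<close> is an admissible choice, and conversely an admissible \<open>m\<close> satisfies
  \<open>-m \<le> d\<^sub>i\<close>, which is what the weight computation uses; the result no longer mentions \<open>m\<close>.
\<close>

lemma Ldet_restriction_t_pow: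
  fixes d :: "int ^ 'n"
  shows "Ldet_restriction (t_pow d) =
    Poly_Mapping.single d (qv powi (\<Sum>i\<in>UNIV. d $ i * (d $ i - 1) div 2))"
proof -
  let ?P = "\<lambda>m. scaled_lattice (int m) \<subseteq> t_pow d \<and> t_pow d \<subseteq> scaled_lattice (- int m)"
  have P_iff: "?P m \<longleftrightarrow> (\<forall>i. \<bar>d $ i\<bar> \<le> int m)" for m
    by (auto simp: scaled_lattice_eq_t_pow t_pow_subset_iff abs_le_iff) (metis minus_le_iff)+
  have "\<bar>d $ i\<bar> \<le> (\<Sum>j\<in>UNIV. \<bar>d $ j\<bar>)" for i
    by (rule member_le_sum) auto
  then have "?P (nat (\<Sum>j\<in>UNIV. \<bar>d $ j\<bar>))"
    unfolding P_iff by (simp add: sum_nonneg)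
  then have "?P (SOME m. ?P m)"
    by (rule someI)
  then have "- int (SOME m. ?P m) \<le> d $ i" for i
    unfolding P_iff by (simp add: abs_le_iff minus_le_iff)
  then show ?thesis
    unfolding Ldet_restriction_def by (intro character_class_eqI det_fibre_character_t_pow)
qed


section \<open>Supports of the restrictions\<close>

text \<open>
  The bound on the right does not involve \<open>d\<close>: the substitution scales each term by a power of \<open>q\<close>,
  which can create cancellations among terms with equal \<open>a + b\<close> but no new characters.
\<close>

lemma keys_gamma: "Poly_Mapping.keys (gamma d f) \<subseteq> (\<lambda>(a, b). a + b) ` Poly_Mapping.keys f"
proof
  fix c assume "c \<in> Poly_Mapping.keys (gamma d f)"
  then have "(\<Sum>k\<in>Poly_Mapping.keys f. Poly_Mapping.lookup f k *
      qv powi (\<Sum>i\<in>UNIV. d $ i * snd k $ i) when fst k + snd k = c) \<noteq> 0"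
    by (simp add: in_keys_iff gamma_eq lookup_sum lookup_single)
  then obtain k where "k \<in> Poly_Mapping.keys f" "fst k + snd k = c"
    by (auto elim!: sum.not_neutral_contains_not_neutral)
  then show "c \<in> (\<lambda>(a, b). a + b) ` Poly_Mapping.keys f"
    by (force simp: case_prod_unfold)
qed

lemma infinite_UNIV_int_vec: "infinite (UNIV :: (int ^ 'n) set)"
proof
  assume "finite (UNIV :: (int ^ 'n) set)"
  moreover have "inj (\<lambda>k :: int. (\<chi> i. k) :: int ^ 'n)"
    by (rule injI) (simp add: Finite_Cartesian_Product.vec_eq_iff)
  ultimately have "finite (UNIV :: int set)"
    using finite_imageD finite_subset subset_UNIV by metis
  then show False by simp
qed

theorem lemmaA7:
  shows "\<not> (\<exists>f \<in> (deformation_ring :: ((int ^ 'n) \<times> (int ^ 'n) \<Rightarrow>\<^sub>0 complex poly fract) set).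
           \<forall>d :: int ^ 'n. gamma d f = Ldet_restriction (t_pow d))"
proof
  assume "\<exists>f \<in> (deformation_ring :: ((int ^ 'n) \<times> (int ^ 'n) \<Rightarrow>\<^sub>0 complex poly fract) set).
    \<forall>d :: int ^ 'n. gamma d f = Ldet_restriction (t_pow d)"
  then obtain f :: "(int ^ 'n) \<times> (int ^ 'n) \<Rightarrow>\<^sub>0 complex poly fract"
    where f: "\<And>d. gamma d f = Ldet_restriction (t_pow d)"
    by blast
  have "d \<in> (\<lambda>(a, b). a + b) ` Poly_Mapping.keys f" for d
  proof -
    have "d \<in> Poly_Mapping.keys (gamma d f)"
      by (simp add: f Ldet_restriction_t_pow)
    then show ?thesis
      using keys_gamma by blast
  qed
  then have "finite (UNIV :: (int ^ 'n) set)"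
    by (intro finite_subset[OF _ finite_imageI[OF finite_keys[of f]]]) blast
  then show False
    using infinite_UNIV_int_vec by contradiction
qed

end
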